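(* Consider inverse limits $(X,f)$ of bidirectional proximal KR-coverings $G_0\xleftarrow{\varphi_1}G_1\xleftarrow{\varphi_2}\cdots$ such that for every $n\ge1$ the graph $G_n$ has exactly two circuits, $e_n$ of length $1$ and $c_n$, and $$\varphi_{n+1}(c_{n+1})=e_n^{s(n)}\,c_n^{\bar t(n)}\,e_n^{s'(n)}\qquad(n\ge1),$$ where $s(n),s'(n)$ are positive integers and $\bar t(n)=t(n)+t'(n)$ with integers $t(n),t'(n)\ge2$. There exist such a covering and sequences $s(n)=s'(n)$ and $\bar t(n)$ ($n\ge1$) such that $(X,f)$ is not topologically mixing but is weakly mixing and uniquely ergodic.
   Context: Dynamics. A homeomorphic system $(X,f)$ is topologically mixing if for all non-empty open $U,V\subseteq X$ there is $N>0$ with $f^n(U)\cap V\ne\emptyset$ for all $n\ge N$. It is topologically transitive if some $x\in X$ has dense forward orbit $\{f^n(x):n\ge0\}$, and weakly mixing if $(X\times X,f\times f)$ is topologically transitive. Uniquely ergodic means having exactly one invariant Borel probability measure. Graph coverings. A finite directed graph $G=(V(G),E(G))$ has $E(G)\subseteq V(G)\times V(G)$, and every vertex is assumed to have an incoming and an outgoing edge. A graph homomorphism $\varphi:G_1\to G_2$ is edge-surjective if $\varphi(E(G_1))=E(G_2)$; it is $+$directional if $(u,v),(u,v')\in E(G_1)$ implies $\varphi(v)=\varphi(v')$; it is bidirectional if moreover $(u,v),(u',v)\in E(G_1)$ implies $\varphi(u)=\varphi(u')$. A cover is a $+$directional edge-surjective homomorphism. A covering is a sequence of covers $G_0\xleftarrow{\varphi_1}G_1\xleftarrow{\varphi_2}\cdots$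 with $G_0$ the graph with one vertex and one loop; it is bidirectional if all $\varphi_n$ are. Its inverse limit is $(X,f)$ with $X=\{(v_0,v_1,\dots)\in\prod_nV(G_n): v_n=\varphi_{n+1}(v_{n+1})\}$ (product topology) and $f(x)=y$ iff $(u_n,v_n)\in E(G_n)$ for all $n$, where $x=(u_n)_n$, $y=(v_n)_n$. A circuit of length $l\ge1$ is a closed walk $(v_0,\dots,v_l=v_0)$ with $v_0,\dots,v_{l-1}$ distinct. A generalized figure 8 is a graph $G$ with a center $v_0$ and distinct circuits starting at $v_0$, pairwise meeting only in $v_0$, whose edges exhaust $E(G)$. A KR-covering is a covering in which each $G_n$ is a generalized figure 8 with center $v_{n,0}$ and $\varphi_{n+1}(v_{n+1,0})=v_{n,0}$ for all $n\ge0$. It is proximal if for each $n\ge1$ the graph $G_n$ has a unique circuit of length $1$. Images of walks are taken vertexwise; products and powers of closed walks at the center denote concatenation. Such inverse limits are proximal Cantor systems with topological rank $2$. *)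

theory Defs
  imports "HOL-Probability.Probability" "Graph_Theory.Pair_Digraph" "Graph_Theory.Vertex_Walk"
begin

section \<open>Dynamics\<close>

text \<open>A system is a subset \<open>X\<close> of a topological space, with the subspace topology, and a
  map \<open>f\<close> which is only used on \<open>X\<close>.\<close>

definition topologically_mixing :: "'a::topological_space set \<Rightarrow> ('a \<Rightarrow> 'a) \<Rightarrow> bool" where
  "topologically_mixing X f \<longleftrightarrow>
     (\<forall>U V. openin (top_of_set X) U \<and> U \<noteq> {} \<and> openin (top_of_set X) V \<and> V \<noteq> {} \<longrightarrow>
        (\<exists>N>0. \<forall>n\<ge>N. (f ^^ n) ` U \<inter> V \<noteq> {}))"

definition topologically_transitive :: "'a::topological_space set \<Rightarrow> ('a \<Rightarrow> 'a) \<Rightarrow> bool" where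
  "topologically_transitive X f \<longleftrightarrow> (\<exists>x\<in>X. X \<subseteq> closure {(f ^^ n) x |n. True})"

definition weakly_mixing :: "'a::topological_space set \<Rightarrow> ('a \<Rightarrow> 'a) \<Rightarrow> bool" where
  "weakly_mixing X f \<longleftrightarrow> topologically_transitive (X \<times> X) (map_prod f f)"

text \<open>\<open>restrict_space borel X\<close> is the Borel sigma-algebra of the subspace \<open>X\<close>.\<close>

definition invariant_borel_probability ::
  "'a::topological_space set \<Rightarrow> ('a \<Rightarrow> 'a) \<Rightarrow> 'a measure \<Rightarrow> bool" where
  "invariant_borel_probability X f M \<longleftrightarrow>
     prob_space M \<and> sets M = sets (restrict_space borel X) \<and> f \<in> measurable M M \<and>
     (\<forall>A\<in>sets M. emeasure M (f -` A \<inter> space M) = emeasure M A)"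

definition uniquely_ergodic :: "'a::topological_space set \<Rightarrow> ('a \<Rightarrow> 'a) \<Rightarrow> bool" where
  "uniquely_ergodic X f \<longleftrightarrow> (\<exists>!M. invariant_borel_probability X f M)"


section \<open>Graphs and covers\<close>

definition covering_graph :: "'v pair_pre_digraph \<Rightarrow> bool" where
  "covering_graph G \<longleftrightarrow> pair_fin_digraph G \<and>
     (\<forall>v\<in>pverts G. (\<exists>u. (u, v) \<in> parcs G) \<and> (\<exists>w. (v, w) \<in> parcs G))"

definition graph_hom ::
  "'v pair_pre_digraph \<Rightarrow> 'w pair_pre_digraph \<Rightarrow> ('v \<Rightarrow> 'w) \<Rightarrow> bool" where
  "graph_hom G H \<phi> \<longleftrightarrow>
     \<phi> ` pverts G \<subseteq> pverts H \<and> (\<forall>(u, v)\<in>parcs G. (\<phi> u, \<phi> v) \<in> parcs H)"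

definition edge_surjective ::
  "'v pair_pre_digraph \<Rightarrow> 'w pair_pre_digraph \<Rightarrow> ('v \<Rightarrow> 'w) \<Rightarrow> bool" where
  "edge_surjective G H \<phi> \<longleftrightarrow> map_prod \<phi> \<phi> ` parcs G = parcs H"

definition plus_directional :: "'v pair_pre_digraph \<Rightarrow> ('v \<Rightarrow> 'w) \<Rightarrow> bool" where
  "plus_directional G \<phi> \<longleftrightarrow>
     (\<forall>u v v'. (u, v) \<in> parcs G \<and> (u, v') \<in> parcs G \<longrightarrow> \<phi> v = \<phi> v')"

definition bidirectional :: "'v pair_pre_digraph \<Rightarrow> ('v \<Rightarrow> 'w) \<Rightarrow> bool" where
  "bidirectional G \<phi> \<longleftrightarrow> plus_directional G \<phi> \<and>
     (\<forall>u u' v. (u, v) \<in> parcs G \<and> (u', v) \<in> parcs G \<longrightarrow> \<phi> u = \<phi> u')"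

definition cover ::
  "'v pair_pre_digraph \<Rightarrow> 'w pair_pre_digraph \<Rightarrow> ('v \<Rightarrow> 'w) \<Rightarrow> bool" where
  "cover G H \<phi> \<longleftrightarrow> graph_hom G H \<phi> \<and> plus_directional G \<phi> \<and> edge_surjective G H \<phi>"

text \<open>The bonding map \<open>G (Suc n) \<rightarrow> G n\<close> is \<open>\<phi> (Suc n)\<close>; the value \<open>\<phi> 0\<close> is not used.\<close>

definition graph_covering ::
  "(nat \<Rightarrow> 'v pair_pre_digraph) \<Rightarrow> (nat \<Rightarrow> 'v \<Rightarrow> 'v) \<Rightarrow> bool" where
  "graph_covering G \<phi> \<longleftrightarrow>
     (\<forall>n. covering_graph (G n)) \<and>
     (\<exists>v. pverts (G 0) = {v} \<and> parcs (G 0) = {(v, v)}) \<and>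
     (\<forall>n. cover (G (Suc n)) (G n) (\<phi> (Suc n)))"

definition bidirectional_covering ::
  "(nat \<Rightarrow> 'v pair_pre_digraph) \<Rightarrow> (nat \<Rightarrow> 'v \<Rightarrow> 'v) \<Rightarrow> bool" where
  "bidirectional_covering G \<phi> \<longleftrightarrow>
     graph_covering G \<phi> \<and> (\<forall>n. bidirectional (G (Suc n)) (\<phi> (Suc n)))"

definition inverse_limit ::
  "(nat \<Rightarrow> 'v pair_pre_digraph) \<Rightarrow> (nat \<Rightarrow> 'v \<Rightarrow> 'v) \<Rightarrow> (nat \<Rightarrow> 'v) set" where
  "inverse_limit G \<phi> =
     {x. \<forall>n. x n \<in> pverts (G n) \<and> x n = \<phi> (Suc n) (x (Suc n))}"

text \<open>For \<open>x\<close> in the inverse limit of a covering there is exactly one such \<open>y\<close>: by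
  +directionality \<open>y n\<close> is \<open>\<phi> (Suc n) w\<close> for any edge \<open>(x (Suc n), w)\<close> of \<open>G (Suc n)\<close>.\<close>

definition inverse_limit_map ::
  "(nat \<Rightarrow> 'v pair_pre_digraph) \<Rightarrow> (nat \<Rightarrow> 'v \<Rightarrow> 'v) \<Rightarrow> (nat \<Rightarrow> 'v) \<Rightarrow> (nat \<Rightarrow> 'v)" where
  "inverse_limit_map G \<phi> x =
     (THE y. y \<in> inverse_limit G \<phi> \<and> (\<forall>n. (x n, y n) \<in> parcs (G n)))"


section \<open>Circuits and KR-coverings\<close>

text \<open>A closed walk is the list of all its vertices, so the base point occurs at both ends and
  the loop at \<open>v\<close> is \<open>[v, v]\<close>. Circuits are based: rotations of a circuit are different lists.\<close>

definition circuit :: "'v pair_pre_digraph \<Rightarrow> 'v vwalk \<Rightarrow> bool" where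
  "circuit G p \<longleftrightarrow> vwalk p (with_proj G) \<and> vwalk_length p \<ge> 1 \<and>
     hd p = last p \<and> distinct (butlast p)"

definition generalized_figure_8 :: "'v pair_pre_digraph \<Rightarrow> 'v \<Rightarrow> bool" where
  "generalized_figure_8 G v \<longleftrightarrow> v \<in> pverts G \<and>
     (\<exists>C. (\<forall>p\<in>C. circuit G p \<and> hd p = v) \<and>
          (\<forall>p\<in>C. \<forall>q\<in>C. p \<noteq> q \<longrightarrow> set p \<inter> set q = {v}) \<and>
          (\<Union>p\<in>C. set (vwalk_arcs p)) = parcs G)"

definition KR_covering ::
  "(nat \<Rightarrow> 'v pair_pre_digraph) \<Rightarrow> (nat \<Rightarrow> 'v \<Rightarrow> 'v) \<Rightarrow> (nat \<Rightarrow> 'v) \<Rightarrow> bool" where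
  "KR_covering G \<phi> v \<longleftrightarrow> graph_covering G \<phi> \<and>
     (\<forall>n. generalized_figure_8 (G n) (v n)) \<and> (\<forall>n. \<phi> (Suc n) (v (Suc n)) = v n)"

definition proximal_covering :: "(nat \<Rightarrow> 'v pair_pre_digraph) \<Rightarrow> bool" where
  "proximal_covering G \<longleftrightarrow> (\<forall>n\<ge>1. \<exists>!p. circuit (G n) p \<and> vwalk_length p = 1)"

text \<open>The zeroth power of a closed walk is the trivial walk at its base point; \<open>\<oplus>\<close> is the
  concatenation of vertex walks, which lists the common end point once.\<close>

primrec closed_walk_power :: "'v vwalk \<Rightarrow> nat \<Rightarrow> 'v vwalk" where
  "closed_walk_power p 0 = [hd p]"
| "closed_walk_power p (Suc k) = p \<oplus> closed_walk_power p k"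

end

theory Submission
  imports Defs
begin

text \<open>Every graph of the covering is a cycle of some length \<open>L\<^sub>n\<close> with a loop at its centre \<open>0\<close>, and
  the cycle of level \<open>n + 1\<close> rests for \<open>p\<^sub>n\<close> steps at the centre, runs \<open>t\<^sub>n\<close> times around the cycle of
  level \<open>n\<close>, and rests for another \<open>p\<^sub>n\<close> steps. Hence \<open>L\<^bsub>n+1\<^esub> = 2 p\<^sub>n + t\<^sub>n L\<^sub>n\<close>, and the three dynamical
  properties become properties of these numbers. The locale \<open>padded_tower\<close> keeps the numbers general;
  each property has its own arithmetic condition.

  \<^item> Not mixing (\<open>not_topologically_mixing\<close>): if \<open>2 p\<^sub>m \<ge> t\<^sub>m L\<^sub>m\<close>, then \<open>k = t\<^sub>m L\<^sub>m\<close> is not a return time to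
    the cylinder of points off the centre. Such a point sits between the two pads of
    the cycle of level \<open>m + 1\<close>; after \<open>k\<close> steps it has left the copies behind, but it has not had the time to
    pass the pads and reach the copies again. Infinitely many such \<open>m\<close> exclude mixing.

  \<^item> Weakly mixing (\<open>weakly_mixing\<close>): moving two points from given positions \<open>P\<close>, \<open>Q\<close> to given positions
    \<open>U\<close>, \<open>V\<close> at one common time requires lifts of the positions to a higher level with
    \<open>U - P = V - Q\<close>. Since a position has \<open>t\<^sub>m\<close> lifts to the next level, spaced by \<open>L\<^sub>m\<close>, each level allows to
    change the defect \<open>(U - P) - (V - Q)\<close> by \<open>r L\<^sub>m\<close> with \<open>\<bar>r\<bar> \<le> 2 (t\<^sub>m - 1)\<close>. If \<open>L\<^bsub>m+1\<^esub> = q L\<^sub>m + 1\<close> with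
    \<open>q \<le> 2 (t\<^sub>m - 1)\<close>, then two consecutive levels change the defect by \<open>L\<^bsub>m+1\<^esub> - q L\<^sub>m = 1\<close>. With infinitely many
    such levels every defect can be removed, one unit at a time, and a chain of such lifts
    yields a pair of points with dense joint orbit.

  \<^item> Uniquely ergodic (\<open>uniquely_ergodic\<close>): for an invariant probability all vertices of a cycle other than the
    centre have the same mass \<open>b\<^sub>n\<close>, so \<open>(L\<^sub>n - 1) b\<^sub>n \<le> 1\<close>, while counting lifts gives \<open>b\<^sub>n = t\<^sub>n b\<^bsub>n+1\<^esub>\<close>. If
    \<open>(\<Prod>i<n. t\<^sub>i) / L\<^sub>n\<close> tends to \<open>0\<close>, then \<open>b\<^sub>n = 0\<close> and the point mass at the fixed point \<open>(0, 0, \<dots>)\<close> is the only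
    invariant probability.

  All conditions hold for \<open>t\<^sub>n = 5\<close> and for lengths with \<open>L\<^bsub>n+1\<^esub> = 6 L\<^sub>n + 1\<close> for even \<open>n\<close> (narrow padding, serving
  weak mixing) and \<open>L\<^bsub>n+1\<^esub> = 10 L\<^sub>n + 1\<close> for odd \<open>n\<close> (wide padding, preventing mixing); the
  quotient \<open>5\<^sup>n / L\<^sub>n\<close> is at most \<open>(5 / 6)\<^sup>n\<close>. All \<open>L\<^sub>n\<close> are odd, so that the padding can be split evenly.\<close>

section \<open>A cycle with a loop\<close>

text \<open>The graph is meant for \<open>0 < l\<close>. For \<open>l = 1\<close> the cycle coincides with the loop, so that the
  one-vertex graph at the bottom of a covering is an instance as well.\<close>

definition loop_cycle :: "nat \<Rightarrow> nat pair_pre_digraph" where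
  "loop_cycle l = \<lparr>pverts = {..<l}, parcs = insert (0, 0) ((\<lambda>j. (j, Suc j mod l)) ` {..<l})\<rparr>"

definition cycle_walk :: "nat \<Rightarrow> nat vwalk" where
  "cycle_walk l = [0..<l] @ [0]"

lemma pverts_loop_cycle [simp]: "pverts (loop_cycle l) = {..<l}"
  by (simp add: loop_cycle_def)

lemma parcs_loop_cycle:
  "parcs (loop_cycle l) = insert (0, 0) ((\<lambda>j. (j, Suc j mod l)) ` {..<l})"
  by (simp add: loop_cycle_def)

lemma arc_loop_cycle_iff:
  "(u, w) \<in> parcs (loop_cycle l) \<longleftrightarrow> u = 0 \<and> w = 0 \<or> u < l \<and> w = Suc u mod l"
  by (auto simp: parcs_loop_cycle)

text \<open>Circuits are handled by positions in the list, which turns the recursive list of arcs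
  into statements about consecutive entries.\<close>

lemma set_vwalk_arcs: "set (vwalk_arcs p) = (\<lambda>i. (p ! i, p ! Suc i)) ` {..<length p - 1}"
proof (induction p rule: vwalk_arcs.induct)
  case (3 x y xs)
  have "{..<length (x # y # xs) - 1} = insert 0 (Suc ` {..<length (y # xs) - 1})"
    by (auto simp: image_iff less_Suc_eq_0_disj)
  then show ?case using 3 by (simp add: image_image)
qed auto

lemma covering_graph_loop_cycle:
  assumes "0 < l" shows "covering_graph (loop_cycle l)"
  unfolding covering_graph_def
proof (intro conjI ballI)
  show "pair_fin_digraph (loop_cycle l)"
    using assms by unfold_locales (auto simp: arc_loop_cycle_iff parcs_loop_cycle)
  fix v assume v: "v \<in> pverts (loop_cycle l)"
  then show "\<exists>w. (v, w) \<in> parcs (loop_cycle l)"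
    by (auto simp: arc_loop_cycle_iff)
  show "\<exists>u. (u, v) \<in> parcs (loop_cycle l)"
    using v by (intro exI[of _ "v - 1"], cases v) (auto simp: arc_loop_cycle_iff)
qed

lemma cycle_walk_nth:
  assumes "0 < l" "i \<le> l" shows "cycle_walk l ! i = i mod l"
  using assms by (auto simp: cycle_walk_def nth_append)

lemma hd_cycle_walk: "0 < l \<Longrightarrow> hd (cycle_walk l) = 0"
  by (simp add: cycle_walk_def hd_append)

lemma set_vwalk_arcs_cycle_walk:
  assumes "0 < l"
  shows "set (vwalk_arcs (cycle_walk l)) = (\<lambda>j. (j, Suc j mod l)) ` {..<l}"
proof -
  have "length (cycle_walk l) - 1 = l" by (simp add: cycle_walk_def)
  then show ?thesis
    unfolding set_vwalk_arcs using assms by (auto simp: cycle_walk_nth intro!: image_cong)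
qed

lemma circuit_loop: "0 < l \<Longrightarrow> circuit (loop_cycle l) [0, 0]"
  by (auto simp: circuit_def vwalk_def arc_loop_cycle_iff)

lemma circuit_cycle_walk: "0 < l \<Longrightarrow> circuit (loop_cycle l) (cycle_walk l)"
  unfolding circuit_def vwalk_def
  by (auto simp: set_vwalk_arcs_cycle_walk arc_loop_cycle_iff)
     (auto simp: cycle_walk_def hd_append)

text \<open>A circuit that leaves the centre has to follow the cycle: the only vertex with a choice is
  the centre, which it may not meet again before closing up.\<close>

lemma circuit_loop_cycle_cases:
  assumes "circuit (loop_cycle l) p" "hd p = 0"
  shows "p = [0, 0] \<or> p = cycle_walk l"
proof -
  define k where "k = length p - 1"
  have len: "length p = Suc k" "0 < k" and p0: "p ! 0 = 0" and pk: "p ! k = 0"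
    and dist: "distinct (butlast p)"
    using assms by (auto simp: circuit_def k_def hd_conv_nth last_conv_nth vwalk_def)
  have arc: "(p ! i, p ! Suc i) \<in> parcs (loop_cycle l)" if "i < k" for i
    using assms that by (auto simp: circuit_def vwalk_def set_vwalk_arcs k_def)
  have nz: "p ! i \<noteq> 0" if "0 < i" "i < k" for i
    using nth_eq_iff_index_eq[OF dist, of i 0] that len p0 by (simp add: nth_butlast)
  have id: "p ! i = i" if "i < k" for i
    using that
  proof (induction i)
    case (Suc i)
    have "p ! Suc i \<noteq> 0" using nz Suc.prems by simp
    then show ?case
      using arc[of i] Suc by (auto simp: arc_loop_cycle_iff mod_Suc split: if_splits)
  qed (simp add: p0)
  obtain i where i: "k = Suc i" using len by (cases k) auto
  have "(i, 0) \<in> parcs (loop_cycle l)" using arc[of i] id[of i] pk i by simp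
  then have "k = 1 \<or> k = l"
    using i by (auto simp: arc_loop_cycle_iff mod_Suc split: if_splits)
  moreover have p: "p = [0..<k] @ [0]"
    using len pk by (intro nth_equalityI) (auto simp: nth_append id less_Suc_eq)
  ultimately show ?thesis by (auto simp: cycle_walk_def)
qed

lemma based_circuits_loop_cycle:
  assumes "0 < l"
  shows "{p. circuit (loop_cycle l) p \<and> hd p = 0} = {[0, 0], cycle_walk l}"
  using circuit_loop_cycle_cases circuit_loop[OF assms] circuit_cycle_walk[OF assms] assms
  by (auto simp: cycle_walk_def hd_append)

lemma unique_loop_circuit:
  assumes "2 \<le> l"
  shows "\<exists>!p. circuit (loop_cycle l) p \<and> vwalk_length p = 1"
proof (rule ex1I[of _ "[0, 0]"])
  show "circuit (loop_cycle l) [0, 0] \<and> vwalk_length [0, 0 :: nat] = 1"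
    using assms circuit_loop[of l] by simp
  fix p assume p: "circuit (loop_cycle l) p \<and> vwalk_length p = 1"
  then have "length p - 1 = 1" by simp
  then have "length p = Suc (Suc 0)" by arith
  then obtain a b where ab: "p = [a, b]"
    by (auto simp: length_Suc_conv)
  have "(a, b) \<in> parcs (loop_cycle l)" and eq: "b = a"
    using p unfolding ab circuit_def vwalk_def by auto
  then have "a = 0 \<or> a < l \<and> a = Suc a mod l" by (simp add: arc_loop_cycle_iff)
  moreover have "Suc a mod l \<noteq> a" if "a < l"
    using assms that by (simp add: mod_Suc)
  ultimately have "a = 0" by metis
  then show "p = [0, 0]" using ab eq by simp
qed

lemma generalized_figure_8_loop_cycle:
  assumes "0 < l"
  shows "generalized_figure_8 (loop_cycle l) 0"
  unfolding generalized_figure_8_def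
proof (intro conjI exI[of _ "{[0, 0], cycle_walk l}"])
  show "\<forall>p\<in>{[0, 0], cycle_walk l}. circuit (loop_cycle l) p \<and> hd p = 0"
    using assms by (simp add: circuit_loop circuit_cycle_walk hd_cycle_walk)
  show "(\<Union>p\<in>{[0, 0], cycle_walk l}. set (vwalk_arcs p)) = parcs (loop_cycle l)"
    using assms by (simp add: set_vwalk_arcs_cycle_walk parcs_loop_cycle)
qed (use assms in \<open>auto simp: cycle_walk_def\<close>)

lemma closed_walk_power_loop: "closed_walk_power [0, 0] k = replicate (Suc k) (0 :: nat)"
  by (induction k) (simp_all add: vwalk_join_def)

text \<open>Concatenation lists the common centre once, so the power is the reduction modulo the length of
  an unbroken count; positions in it can then be read off directly.\<close>

lemma closed_walk_power_cycle_walk: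
  assumes "0 < l"
  shows "closed_walk_power (cycle_walk l) k = map (\<lambda>j. j mod l) [0..<k * l + 1]"
proof (induction k)
  case 0
  then show ?case using assms by (simp add: cycle_walk_def hd_append)
next
  case (Suc k)
  have eq: "[0..<Suc k * l + 1] = [0..<l + 1] @ map (\<lambda>j. j + l) [1..<k * l + 1]"
    by (rule nth_equalityI) (auto simp: nth_append simp del: upt_Suc)
  have 1: "cycle_walk l = map (\<lambda>j. j mod l) [0..<l + 1]"
    by (auto simp: cycle_walk_def intro!: map_idI[symmetric])
  have 2: "tl (map (\<lambda>j. j mod l) [0..<k * l + 1]) = map (\<lambda>j. j mod l) [1..<k * l + 1]"
    by (subst upt_conv_Cons) simp_all
  show ?case
    unfolding closed_walk_power.simps Suc.IH vwalk_join_def 2 eq map_append map_map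
    using 1 by (simp add: o_def)
qed

section \<open>Towers of padded repetitions\<close>

text \<open>The numbers \<open>pad n\<close> and \<open>rep n\<close> say how the cycle of level \<open>Suc n\<close> runs through level \<open>n\<close>. The
  lengths are determined by them; they are a parameter because in the application the
  padding is chosen in terms of the lengths.\<close>

locale padded_tower =
  fixes len pad rep :: "nat \<Rightarrow> nat"
  assumes len_0: "len 0 = 1"
    and len_Suc: "len (Suc n) = 2 * pad n + rep n * len n"
    and pad_pos: "0 < pad n"
    and rep_pos: "0 < rep n"
begin

text \<open>The map onto level \<open>n\<close> carries the index \<open>Suc n\<close>, hence the predecessors. Along the cycle of
  level \<open>Suc n\<close> the image rests at the centre for \<open>pad n\<close> steps, runs \<open>rep n\<close> times around the cycle of
  level \<open>n\<close>, and rests again; the value at index \<open>0\<close> is arbitrary.\<close>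

definition bond :: "nat \<Rightarrow> nat \<Rightarrow> nat" where
  "bond n j =
     (let m = n - 1 in
      if pad m \<le> j \<and> j < pad m + rep m * len m then (j - pad m) mod len m else 0)"

definition tower :: "nat \<Rightarrow> nat pair_pre_digraph" where
  "tower n = loop_cycle (len n)"

lemma bond_Suc:
  "bond (Suc n) j =
     (if pad n \<le> j \<and> j < pad n + rep n * len n then (j - pad n) mod len n else 0)"
  by (simp add: bond_def)

lemma len_pos [simp]: "0 < len n"
  using pad_pos by (cases n) (simp_all add: len_0 len_Suc)

lemma len_Suc_ge: "len n + 2 \<le> len (Suc n)"
proof -
  have "len n \<le> rep n * len n" using rep_pos[of n] by simp
  then show ?thesis using pad_pos[of n] unfolding len_Suc by linarith
qed

lemma len_ge_2: "1 \<le> n \<Longrightarrow> 2 \<le> len n"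
  using len_Suc_ge[of "n - 1"] by simp

lemma len_ge: "n \<le> len n"
proof (induction n)
  case (Suc n)
  then show ?case using len_Suc_ge[of n] by simp
qed simp

lemma bond_less: "bond (Suc n) j < len n"
  by (simp add: bond_Suc)

lemma bond_0 [simp]: "bond (Suc n) 0 = 0"
  using pad_pos[of n] by (simp add: bond_Suc)

lemma bond_1: "bond (Suc n) (Suc 0) = 0"
  using pad_pos[of n] by (auto simp: bond_Suc)

lemma bond_last: "bond (Suc n) (len (Suc n) - 1) = 0"
  using pad_pos[of n] by (auto simp: bond_Suc len_Suc)

lemma bond_arc:
  assumes "(u, w) \<in> parcs (tower (Suc n))"
  shows "(bond (Suc n) u, bond (Suc n) w) \<in> parcs (tower n)"
proof -
  consider "u = 0" "w = 0" | "Suc u < len (Suc n)" "w = Suc u" | "Suc u = len (Suc n)" "w = 0"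
    using assms by (fastforce simp: tower_def arc_loop_cycle_iff mod_Suc split: if_splits)
  then show ?thesis
  proof cases
    case 2
    consider "Suc u < pad n" | "Suc u = pad n" | "pad n \<le> u" "u < pad n + rep n * len n"
      | "pad n + rep n * len n \<le> u" by linarith
    then show ?thesis
    proof cases
      case 3
      have "bond (Suc n) (Suc u) = Suc (u - pad n) mod len n"
      proof (cases "Suc u < pad n + rep n * len n")
        case True then show ?thesis using 3 by (simp add: bond_Suc Suc_diff_le)
      next
        case False
        then have "Suc (u - pad n) = rep n * len n" using 3 by simp
        then show ?thesis using 3 False by (simp add: bond_Suc)
      qed
      then show ?thesis using 2 3
        by (auto simp: bond_Suc tower_def arc_loop_cycle_iff mod_Suc_eq)
    qed (use 2 in \<open>auto simp: bond_Suc tower_def arc_loop_cycle_iff\<close>)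
  next
    case 3
    then have "u = len (Suc n) - 1" by simp
    then show ?thesis using 3 bond_last[of n] by (simp add: tower_def arc_loop_cycle_iff)
  qed (simp add: tower_def arc_loop_cycle_iff)
qed

text \<open>The \<open>i\<close>-th copy of the cycle of level \<open>n\<close> starts at \<open>pad n + i * len n\<close>.\<close>

lemma bond_copy:
  assumes "j < len n" "i < rep n"
  shows "bond (Suc n) (pad n + i * len n + j) = j"
    and "pad n + i * len n + j < pad n + rep n * len n"
proof -
  have "Suc i * len n \<le> rep n * len n" using assms by (intro mult_right_mono) auto
  then show *: "pad n + i * len n + j < pad n + rep n * len n" using assms(1) by simp
  show "bond (Suc n) (pad n + i * len n + j) = j"
    using * assms(1) by (simp add: bond_Suc add.assoc)
qed

text \<open>Vertex \<open>1\<close> has exactly one preimage in each copy and none in the pads. The centre is different: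
  its preimages include the pads, which is why frequencies are counted at vertex \<open>1\<close>.\<close>

lemma bond_eq_1_iff:
  assumes "1 \<le> n"
  shows "bond (Suc n) k = 1 \<longleftrightarrow> k \<in> (\<lambda>i. pad n + i * len n + 1) ` {..<rep n}"
proof
  assume *: "bond (Suc n) k = 1"
  then have k: "pad n \<le> k" "k < pad n + rep n * len n" "(k - pad n) mod len n = 1"
    by (auto simp: bond_Suc split: if_splits)
  have "(k - pad n) div len n < rep n"
    using k(1,2) by (simp add: div_less_iff_less_mult)
  moreover have "k = pad n + (k - pad n) div len n * len n + 1"
    using k(1) div_mult_mod_eq[of "k - pad n" "len n"] k(3) by simp
  ultimately show "k \<in> (\<lambda>i. pad n + i * len n + 1) ` {..<rep n}" by blast
next
  assume "k \<in> (\<lambda>i. pad n + i * len n + 1) ` {..<rep n}"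
  then show "bond (Suc n) k = 1" using bond_copy(1)[of 1 n] len_ge_2[OF assms] by auto
qed

lemma bond_edge_surjective: "edge_surjective (tower (Suc n)) (tower n) (bond (Suc n))"
  unfolding edge_surjective_def
proof
  show "map_prod (bond (Suc n)) (bond (Suc n)) ` parcs (tower (Suc n)) \<subseteq> parcs (tower n)"
    using bond_arc by auto
  have "(j, Suc j mod len n) \<in> map_prod (bond (Suc n)) (bond (Suc n)) ` parcs (tower (Suc n))"
    if j: "j < len n" for j
  proof (rule image_eqI)
    let ?k = "pad n + j"
    have less: "?k < pad n + rep n * len n"
      using bond_copy(2)[of j n 0] j rep_pos[of n] by simp
    then have k: "Suc ?k < len (Suc n)" using pad_pos[of n] by (simp add: len_Suc)
    then show "(?k, Suc ?k) \<in> parcs (tower (Suc n))"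
      by (simp add: tower_def arc_loop_cycle_iff)
    have "bond (Suc n) (Suc ?k) = Suc j mod len n"
    proof (cases "Suc ?k < pad n + rep n * len n")
      case True
      then show ?thesis by (simp add: bond_Suc Suc_diff_le)
    next
      case False
      then have "Suc j = rep n * len n" using less by simp
      then show ?thesis by (simp add: bond_Suc)
    qed
    then show "(j, Suc j mod len n) = map_prod (bond (Suc n)) (bond (Suc n)) (?k, Suc ?k)"
      using less j by (simp add: bond_Suc)
  qed
  moreover have "(0, 0) \<in> map_prod (bond (Suc n)) (bond (Suc n)) ` parcs (tower (Suc n))"
    by (rule image_eqI[of _ _ "(0, 0)"]) (simp_all add: tower_def arc_loop_cycle_iff)
  ultimately show
    "parcs (tower n) \<subseteq> map_prod (bond (Suc n)) (bond (Suc n)) ` parcs (tower (Suc n))"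
    by (auto simp: tower_def parcs_loop_cycle)
qed

text \<open>Only the centre has two successors or two predecessors. Its neighbours on the cycle have the same
  image as the centre: the last vertex lies in the second pad, and vertex \<open>1\<close> lies in the first pad or,
  if that has length one, at the start of the first copy.\<close>

lemma bond_bidirectional: "bidirectional (tower (Suc n)) (bond (Suc n))"
proof -
  have "bond (Suc n) w = bond (Suc n) w'"
    if "(u, w) \<in> parcs (tower (Suc n))" "(u, w') \<in> parcs (tower (Suc n))" for u w w'
    using that len_ge_2[of "Suc n"]
    by (auto simp: tower_def arc_loop_cycle_iff bond_1)
  moreover have "bond (Suc n) u = bond (Suc n) u'"
    if "(u, w) \<in> parcs (tower (Suc n))" "(u', w) \<in> parcs (tower (Suc n))" for u u' w
  proof -
    have *: "bond (Suc n) u = 0" if "(u, 0) \<in> parcs (tower (Suc n))" for u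
    proof -
      have "u = 0 \<or> u = len (Suc n) - 1"
        using that by (auto simp: tower_def arc_loop_cycle_iff mod_Suc split: if_splits)
      then show ?thesis using bond_last[of n] by auto
    qed
    show ?thesis
    proof (cases "w = 0")
      case True then show ?thesis using * that by simp
    next
      case False
      then have "Suc u = w" "Suc u' = w"
        using that by (auto simp: tower_def arc_loop_cycle_iff mod_Suc split: if_splits)
      then have "u = u'" by simp
      then show ?thesis by simp
    qed
  qed
  ultimately show ?thesis unfolding bidirectional_def plus_directional_def by blast
qed

lemma bidirectional_covering_tower: "bidirectional_covering tower bond"
  unfolding bidirectional_covering_def graph_covering_def cover_def
proof (intro conjI allI)
  show "covering_graph (tower n)" for n
    by (simp add: tower_def covering_graph_loop_cycle)
  show "\<exists>v. pverts (tower 0) = {v} \<and> parcs (tower 0) = {(v, v)}"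
    by (auto simp: tower_def len_0 parcs_loop_cycle)
  show "graph_hom (tower (Suc n)) (tower n) (bond (Suc n))" for n
    using bond_less bond_arc by (auto simp: graph_hom_def tower_def)
  show "edge_surjective (tower (Suc n)) (tower n) (bond (Suc n))" for n
    by (rule bond_edge_surjective)
  show "bidirectional (tower (Suc n)) (bond (Suc n))" for n by (rule bond_bidirectional)
  then show "plus_directional (tower (Suc n)) (bond (Suc n))" for n
    by (simp add: bidirectional_def)
qed

lemma KR_covering_tower: "KR_covering tower bond (\<lambda>_. 0)"
  using bidirectional_covering_tower generalized_figure_8_loop_cycle
  by (simp add: KR_covering_def bidirectional_covering_def tower_def)

lemma proximal_covering_tower: "proximal_covering tower"
  unfolding proximal_covering_def tower_def using unique_loop_circuit len_ge_2 by blast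

lemma bond_cycle_walk:
  "map (bond (Suc n)) (cycle_walk (len (Suc n))) =
     closed_walk_power [0, 0] (pad n) \<oplus> closed_walk_power (cycle_walk (len n)) (rep n)
       \<oplus> closed_walk_power [0, 0] (pad n)" (is "_ = ?W")
proof (rule nth_equalityI)
  have W: "?W = replicate (pad n) 0 @ map (\<lambda>j. j mod len n) [0..<rep n * len n + 1]
      @ replicate (pad n) 0"
    (is "_ = ?W'")
  proof -
    have "[0..<rep n * len n + 1] = 0 # [1..<rep n * len n + 1]"
      by (subst upt_conv_Cons) simp_all
    then show ?thesis
      unfolding closed_walk_power_loop closed_walk_power_cycle_walk[OF len_pos] vwalk_join_def
      by (simp add: replicate_app_Cons_same del: upt_Suc)
  qed
  show len: "length (map (bond (Suc n)) (cycle_walk (len (Suc n)))) = length ?W"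
    unfolding W by (simp add: cycle_walk_def len_Suc)
  fix i assume "i < length (map (bond (Suc n)) (cycle_walk (len (Suc n))))"
  then have i: "i \<le> len (Suc n)" by (simp add: cycle_walk_def)
  have *: "bond (Suc n) (i mod len (Suc n)) =
      (if pad n \<le> i \<and> i < pad n + rep n * len n then (i - pad n) mod len n else 0)"
    using i pad_pos[of n] by (cases "i = len (Suc n)") (auto simp: bond_Suc len_Suc)
  show "map (bond (Suc n)) (cycle_walk (len (Suc n))) ! i = ?W ! i"
  proof -
    have "i - pad n = rep n * len n \<or> i - pad n < rep n * len n \<or> rep n * len n < i - pad n"
      by linarith
    then have "?W' ! i = (if pad n \<le> i \<and> i < pad n + rep n * len n then (i - pad n) mod len n else 0)"
      using i by (auto simp: nth_append len_Suc simp del: upt_Suc)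
    moreover have "i < length (cycle_walk (len (Suc n)))"
      using i by (simp add: cycle_walk_def)
    then have "map (bond (Suc n)) (cycle_walk (len (Suc n))) ! i = bond (Suc n) (i mod len (Suc n))"
      using i by (simp add: cycle_walk_nth)
    ultimately show ?thesis
      unfolding W * by simp
  qed
qed

section \<open>The inverse limit and its dynamics\<close>

abbreviation X :: "(nat \<Rightarrow> nat) set" where "X \<equiv> inverse_limit tower bond"
abbreviation f :: "(nat \<Rightarrow> nat) \<Rightarrow> (nat \<Rightarrow> nat)" where "f \<equiv> inverse_limit_map tower bond"

lemma mem_X_iff: "x \<in> X \<longleftrightarrow> (\<forall>n. x n < len n \<and> x n = bond (Suc n) (x (Suc n)))"
  unfolding inverse_limit_def tower_def pverts_loop_cycle mem_Collect_eq lessThan_iff ..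

lemma coordinate_less: "x \<in> X \<Longrightarrow> x n < len n"
  unfolding mem_X_iff by blast

lemma bond_coordinate: "x \<in> X \<Longrightarrow> bond (Suc n) (x (Suc n)) = x n"
  unfolding mem_X_iff by (drule spec, drule conjunct2, erule sym)

lemma mem_XI:
  assumes "\<And>n. x n < len n" "\<And>n. bond (Suc n) (x (Suc n)) = x n"
  shows "x \<in> X"
  unfolding mem_X_iff by (intro allI conjI assms(1) assms(2)[symmetric])

lemma bond_successor_unique:
  assumes "(u, w) \<in> parcs (tower (Suc n))" "(u, w') \<in> parcs (tower (Suc n))"
  shows "bond (Suc n) w = bond (Suc n) w'"
  using bond_bidirectional[of n] assms unfolding bidirectional_def plus_directional_def by blast

text \<open>A successor of \<open>x (Suc n)\<close> determines the coordinate \<open>n\<close> of the image by +directionality. Choosing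
  the successor along the cycle at every level therefore produces the unique image point.\<close>

lemma f_properties:
  assumes "x \<in> X"
  shows f_mem: "f x \<in> X"
    and f_arc: "(x n, f x n) \<in> parcs (tower n)"
    and f_eq: "f x n = bond (Suc n) (Suc (x (Suc n)) mod len (Suc n))"
proof -
  define y where "y n = bond (Suc n) (Suc (x (Suc n)) mod len (Suc n))" for n
  have succ: "(x n, Suc (x n) mod len n) \<in> parcs (tower n)" for n
    using coordinate_less[OF assms] by (simp add: tower_def arc_loop_cycle_iff)
  have arc: "(x n, y n) \<in> parcs (tower n)" for n
    using bond_arc[OF succ[of "Suc n"]] bond_coordinate[OF assms] by (simp add: y_def)
  have "bond (Suc n) (y (Suc n)) = y n" for n
    using bond_successor_unique[OF succ[of "Suc n"] arc[of "Suc n"]] y_def[of n] by simp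
  then have y: "y \<in> X"
    by (intro mem_XI) (simp_all add: bond_less y_def)
  have unique: "z = y" if "z \<in> X" "\<forall>n. (x n, z n) \<in> parcs (tower n)" for z
  proof
    fix n
    have "z n = bond (Suc n) (z (Suc n))" using bond_coordinate[OF that(1)] by simp
    also have "\<dots> = y n"
      using bond_successor_unique[OF spec[OF that(2), of "Suc n"] succ[of "Suc n"]]
      by (simp add: y_def)
    finally show "z n = y n" .
  qed
  have fx: "f x = y"
    unfolding inverse_limit_map_def
  proof (rule the_equality)
    show "y \<in> X \<and> (\<forall>n. (x n, y n) \<in> parcs (tower n))" by (intro conjI allI y arc)
    show "z = y" if "z \<in> X \<and> (\<forall>n. (x n, z n) \<in> parcs (tower n))" for z
      by (rule unique[OF conjunct1[OF that] conjunct2[OF that]])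
  qed
  show "f x \<in> X" unfolding fx by (rule y)
  show "(x n, f x n) \<in> parcs (tower n)" unfolding fx by (rule arc)
  show "f x n = bond (Suc n) (Suc (x (Suc n)) mod len (Suc n))" unfolding fx by (rule y_def)
qed

lemma iterate_mem: "x \<in> X \<Longrightarrow> (f ^^ k) x \<in> X"
  by (induction k) (auto intro: f_mem)

lemma f_step:
  assumes "x \<in> X" "x n \<noteq> 0"
  shows "f x n = Suc (x n) mod len n"
  using f_arc[OF assms(1), of n] assms(2) by (simp add: tower_def arc_loop_cycle_iff)

lemma f_step_le:
  assumes "x \<in> X"
  shows "f x n \<le> Suc (x n)"
  using f_arc[OF assms(1), of n] by (auto simp: tower_def arc_loop_cycle_iff)

lemma iterate_before_centre:
  assumes "x \<in> X" "0 < x n" "x n + k < len n"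
  shows "(f ^^ k) x n = x n + k"
  using assms(3)
proof (induction k)
  case (Suc k)
  then show ?case
    using f_step[OF iterate_mem[OF assms(1), of k], of n] assms(2) by simp
qed simp

text \<open>A point may rest at the centre through the loop, so the number of steps since the arrival
  there only bounds its position from above.\<close>

lemma iterate_after_centre:
  assumes "x \<in> X" "0 < x n" "len n \<le> x n + k"
  shows "(f ^^ k) x n \<le> x n + k - len n"
  using assms(3)
proof (induction k)
  case 0
  then show ?case using coordinate_less[OF assms(1), of n] by simp
next
  case (Suc k)
  show ?case
  proof (cases "len n \<le> x n + k")
    case True
    then show ?thesis
      using Suc.IH f_step_le[OF iterate_mem[OF assms(1), of k], of n] by simp
  next
    case False
    then have "(f ^^ k) x n = x n + k" "Suc (x n + k) = len n"
      using iterate_before_centre[OF assms(1,2), of k] Suc.prems by auto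
    then show ?thesis
      using f_step[OF iterate_mem[OF assms(1), of k], of n] assms(2) by simp
  qed
qed

text \<open>\<open>down n m j\<close> is the vertex of level \<open>n\<close> under the vertex \<open>j\<close> of level \<open>m\<close>, for \<open>n \<le> m\<close>.\<close>

primrec down :: "nat \<Rightarrow> nat \<Rightarrow> nat \<Rightarrow> nat" where
  "down n 0 j = j"
| "down n (Suc m) j = (if n \<le> m then down n m (bond (Suc m) j) else j)"

lemma down_self [simp]: "down n n j = j"
  by (cases n) auto

lemma down_less: "n \<le> m \<Longrightarrow> j < len m \<Longrightarrow> down n m j < len n"
  by (induction m arbitrary: j) (auto simp: bond_less le_Suc_eq)

lemma down_down: "l \<le> n \<Longrightarrow> n \<le> m \<Longrightarrow> down l n (down n m j) = down l m j"
  by (induction m arbitrary: j) (auto simp: le_Suc_eq)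

lemma down_coordinate: "x \<in> X \<Longrightarrow> n \<le> m \<Longrightarrow> down n m (x m) = x n"
  by (induction m) (auto simp: bond_coordinate le_Suc_eq)

definition over :: "nat \<Rightarrow> nat \<Rightarrow> nat \<Rightarrow> nat \<Rightarrow> bool" where
  "over m' j' m j \<longleftrightarrow> m \<le> m' \<and> j' < len m' \<and> down m m' j' = j"

lemma over_refl: "j < len m \<Longrightarrow> over m j m j"
  by (simp add: over_def)

lemma over_lessD: "over m' j' m j \<Longrightarrow> j' < len m'"
  by (simp add: over_def)

lemma over_trans: "over m'' j'' m' j' \<Longrightarrow> over m' j' m j \<Longrightarrow> over m'' j'' m j"
  by (auto simp: over_def down_down[symmetric, of m m' m''])

lemma over_copy:
  assumes "j < len m" "i < rep m"
  shows "over (Suc m) (pad m + i * len m + j) m j"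
  using bond_copy[OF assms] by (auto simp: over_def len_Suc)

lemma ex_over:
  assumes "j < len m" "m \<le> m'"
  shows "\<exists>j'. over m' j' m j"
  using assms(2)
proof (induction m' rule: dec_induct)
  case base
  then show ?case using over_refl[OF assms(1)] by blast
next
  case (step m')
  then obtain j' where j': "over m' j' m j" by blast
  have "over (Suc m') (pad m' + 0 * len m' + j') m' j'"
    using j' rep_pos[of m'] by (intro over_copy) (auto simp: over_def)
  then show ?case using over_trans j' by blast
qed

text \<open>Points of the inverse limit are specified along a sparse sequence of levels; all other
  coordinates are projections.\<close>

lemma ex_point_through_chain:
  assumes mono: "\<And>i. M i < M (Suc i)" and start: "P 0 < len (M 0)"
    and chain: "\<And>i. over (M (Suc i)) (P (Suc i)) (M i) (P i)"
  shows "\<exists>x\<in>X. \<forall>i. x (M i) = P i"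
proof -
  have chain': "over (M j) (P j) (M i) (P i)" if "i \<le> j" for i j
    using that
  proof (induction j rule: dec_induct)
    case base
    have "P i < len (M i)" using start chain[of "i - 1"] by (cases i) (auto simp: over_def)
    then show ?case by (rule over_refl)
  next
    case (step j)
    then show ?case using over_trans chain by blast
  qed
  have le: "n \<le> M n" for n
    by (rule strict_mono_imp_increasing) (simp add: strict_mono_Suc_iff mono)
  define x where "x n = down n (M n) (P n)" for n
  have x: "x n = down n (M j) (P j)" if "n \<le> j" for n j
    unfolding x_def
    using chain'[OF that] down_down[of n "M n" "M j" "P j"] le[of n] by (simp add: over_def)
  have "x n < len n \<and> bond (Suc n) (x (Suc n)) = x n" for n
  proof -
    have n: "Suc n \<le> M (Suc n)" by (rule le)
    have "P (Suc n) < len (M (Suc n))" using chain by (simp add: over_def)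
    moreover have "x n = down n (M (Suc n)) (P (Suc n))" by (rule x) simp
    moreover have "x (Suc n) = down (Suc n) (M (Suc n)) (P (Suc n))" by (rule x) simp
    moreover have "down n (Suc n) j = bond (Suc n) j" for j by simp
    ultimately show ?thesis
      using down_less[of n "M (Suc n)"] n down_down[of n "Suc n" "M (Suc n)" "P (Suc n)"] by simp
  qed
  then have "x \<in> X" by (intro mem_XI) auto
  moreover have "x (M i) = P i" for i
    using chain'[OF le[of i]] by (simp add: x_def over_def)
  ultimately show ?thesis by blast
qed

lemma ex_point_at:
  assumes "j < len n"
  shows "\<exists>x\<in>X. x n = j"
proof -
  define P where "P = rec_nat j (\<lambda>i p. pad (n + i) + 0 * len (n + i) + p)"
  have P: "P 0 = j" "P (Suc i) = pad (n + i) + 0 * len (n + i) + P i" for i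
    by (simp_all add: P_def)
  have less: "P i < len (n + i)" for i
  proof (induction i)
    case (Suc i)
    then show ?case
      using over_copy[of "P i" "n + i" 0] rep_pos[of "n + i"] by (simp add: over_def P)
  qed (simp add: P assms)
  have "\<exists>x\<in>X. \<forall>i. x (n + i) = P i"
  proof (rule ex_point_through_chain)
    show "over (n + Suc i) (P (Suc i)) (n + i) (P i)" for i
      using over_copy[OF less[of i], of 0] rep_pos[of "n + i"] unfolding P by simp
  qed (use assms in \<open>simp_all add: P\<close>)
  then show ?thesis using P(1) by (metis add_0_right)
qed

section \<open>Wide padding prevents mixing\<close>

lemma continuous_coordinate: "continuous_on A (\<lambda>x :: nat \<Rightarrow> nat. x n)"
  by (rule continuous_on_subset[OF continuous_on_product_coordinates]) simp

text \<open>The bonding maps send the centre to the centre.\<close>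

lemma nonzero_above:
  assumes "x \<in> X" "x n \<noteq> 0" "n \<le> m"
  shows "x m \<noteq> 0"
  using assms(3)
proof (induction m rule: dec_induct)
  case (step m)
  show ?case using step.IH bond_coordinate[OF assms(1), of m] by (metis bond_0)
qed (rule assms(2))

lemma nonzero_between_pads:
  assumes "x \<in> X" "x n \<noteq> 0" "n \<le> m"
  shows "pad m \<le> x (Suc m) \<and> x (Suc m) < pad m + rep m * len m"
proof -
  have "bond (Suc m) (x (Suc m)) \<noteq> 0"
    using nonzero_above[OF assms] bond_coordinate[OF assms(1)] by simp
  then show ?thesis by (auto simp: bond_Suc split: if_splits)
qed

text \<open>Off the centre at level \<open>n\<close>, a point lies between the two pads of the cycle of level \<open>Suc m\<close>, a stretch of length
  \<open>rep m * len m\<close>. After as many steps it has left this stretch, and returning to it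
  takes a walk through both pads, which are together at least as long.\<close>

lemma no_return_after_copies:
  assumes "x \<in> X" "x n \<noteq> 0" "n \<le> m" and wide: "rep m * len m \<le> 2 * pad m"
  shows "(f ^^ (rep m * len m)) x n = 0"
proof (rule ccontr)
  define k where "k = rep m * len m"
  assume "(f ^^ (rep m * len m)) x n \<noteq> 0"
  then have y: "pad m \<le> (f ^^ k) x (Suc m)" "(f ^^ k) x (Suc m) < pad m + k"
    using nonzero_between_pads[OF iterate_mem[OF assms(1)] _ assms(3)] by (auto simp: k_def)
  have x: "pad m \<le> x (Suc m)" "x (Suc m) < pad m + k"
    using nonzero_between_pads[OF assms(1-3)] by (auto simp: k_def)
  have pos: "0 < x (Suc m)" using x pad_pos[of m] by simp
  show False
  proof (cases "x (Suc m) + k < len (Suc m)")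
    case True
    then show False using iterate_before_centre[OF assms(1) pos True] x y by simp
  next
    case False
    then have "(f ^^ k) x (Suc m) \<le> x (Suc m) + k - len (Suc m)"
      using iterate_after_centre[OF assms(1) pos, of k] by simp
    moreover have "len (Suc m) = 2 * pad m + k" by (simp add: len_Suc k_def)
    ultimately show False using x y wide unfolding k_def[symmetric] by linarith
  qed
qed

theorem not_topologically_mixing:
  assumes "\<And>N. \<exists>m\<ge>N. rep m * len m \<le> 2 * pad m"
  shows "\<not> topologically_mixing X f"
proof
  assume mixing: "topologically_mixing X f"
  define U where "U = {x \<in> X. x 1 \<noteq> 0}"
  have "openin (top_of_set X) (X \<inter> (\<lambda>x. x 1) -` (- {0}))"
    by (rule continuous_openin_preimage_gen[OF continuous_coordinate discrete_topology_class.open_discrete])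
  moreover have "X \<inter> (\<lambda>x. x 1) -` (- {0}) = U" by (auto simp: U_def)
  ultimately have op: "openin (top_of_set X) U" by simp
  have "U \<noteq> {}"
    using ex_point_at[of 1 1] len_ge_2[of 1] by (auto simp: U_def)
  then obtain N where N: "\<And>k. k \<ge> N \<Longrightarrow> (f ^^ k) ` U \<inter> U \<noteq> {}"
    using mixing op unfolding topologically_mixing_def by blast
  obtain m where m: "m \<ge> max 1 N" "rep m * len m \<le> 2 * pad m"
    using assms by blast
  have "len m \<le> rep m * len m" using rep_pos[of m] by simp
  then have "N \<le> rep m * len m" using len_ge[of m] m(1) by linarith
  from N[OF this] obtain x where "x \<in> U" "(f ^^ (rep m * len m)) x \<in> U" by blast
  then show False
    using no_return_after_copies[of x 1 m] m by (simp add: U_def)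
qed

end

section \<open>Unit levels and weak mixing\<close>

lemma tendsto_product_topology:
  fixes x :: "'i \<Rightarrow> 'a \<Rightarrow> 'b::topological_space"
  assumes "\<And>i. ((\<lambda>j. x j i) \<longlongrightarrow> l i) F"
  shows "(x \<longlongrightarrow> l) F"
  using assms limitin_componentwise[of "\<lambda>_. euclidean" UNIV x l F]
  by (simp add: euclidean_product_topology)

lemma funpow_map_prod:
  fixes g :: "'a \<Rightarrow> 'a" and h :: "'b \<Rightarrow> 'b"
  shows "map_prod g h ^^ k = map_prod (g ^^ k) (h ^^ k)"
  by (induction k) (auto simp: fun_eq_iff)

context padded_tower
begin

text \<open>Two walks, from \<open>P\<close> to \<open>U\<close> and from \<open>Q\<close> to \<open>V\<close>, can be performed in the same time if the defect
  \<open>(U - P) - (V - Q)\<close> vanishes. The relation \<open>shiftable m m' c\<close> says that lifting to level \<open>m'\<close> can change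
  the defect by \<open>c\<close>. The positions are quantified inside, so that changes at successive levels add up.\<close>

definition shiftable :: "nat \<Rightarrow> nat \<Rightarrow> int \<Rightarrow> bool" where
  "shiftable m m' c \<longleftrightarrow>
     (\<forall>P U Q V. P < len m \<longrightarrow> U < len m \<longrightarrow> Q < len m \<longrightarrow> V < len m \<longrightarrow>
        (\<exists>P' U' Q' V'. over m' P' m P \<and> over m' U' m U \<and> over m' Q' m Q \<and> over m' V' m V \<and>
           (int U' - int P') - (int V' - int Q') = (int U - int P) - (int V - int Q) + c))"

lemma shiftableE:
  assumes "shiftable m m' c" "P < len m" "U < len m" "Q < len m" "V < len m"
  obtains P' U' Q' V' where
    "over m' P' m P" "over m' U' m U" "over m' Q' m Q" "over m' V' m V"
    "(int U' - int P') - (int V' - int Q') = (int U - int P) - (int V - int Q) + c"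
  using assms unfolding shiftable_def by blast

lemma shiftable_refl: "shiftable m m 0"
  unfolding shiftable_def using over_refl by fastforce

lemma shiftable_trans:
  assumes 1: "shiftable m m' c" and 2: "shiftable m' m'' c'"
  shows "shiftable m m'' (c + c')"
  unfolding shiftable_def
proof (intro allI impI)
  fix P U Q V assume less: "P < len m" "U < len m" "Q < len m" "V < len m"
  from shiftableE[OF 1 less] obtain P' U' Q' V' where a:
    "over m' P' m P" "over m' U' m U" "over m' Q' m Q" "over m' V' m V"
    "(int U' - int P') - (int V' - int Q') = (int U - int P) - (int V - int Q) + c" .
  from shiftableE[OF 2 a(1-4)[THEN over_lessD]] obtain P'' U'' Q'' V'' where b:
    "over m'' P'' m' P'" "over m'' U'' m' U'" "over m'' Q'' m' Q'" "over m'' V'' m' V'"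
    "(int U'' - int P'') - (int V'' - int Q'') = (int U' - int P') - (int V' - int Q') + c'" .
  have "(int U'' - int P'') - (int V'' - int Q'') = (int U - int P) - (int V - int Q) + (c + c')"
    using a(5) b(5) by simp
  then show "\<exists>P' U' Q' V'. over m'' P' m P \<and> over m'' U' m U \<and> over m'' Q' m Q \<and> over m'' V' m V \<and>
     (int U' - int P') - (int V' - int Q') = (int U - int P) - (int V - int Q) + (c + c')"
    using a b over_trans by blast
qed

text \<open>Lifting to the copies with numbers \<open>i\<^sub>P, i\<^sub>U, i\<^sub>Q, i\<^sub>V < rep m\<close> changes the defect by
  \<open>(i\<^sub>U - i\<^sub>P - i\<^sub>V + i\<^sub>Q) * len m\<close>; the pads cancel.\<close>

lemma shiftable_level:
  assumes "\<bar>r\<bar> \<le> 2 * (int (rep m) - 1)"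
  shows "shiftable m (Suc m) (r * int (len m))"
proof -
  \<comment> \<open>A positive shift is distributed over the copies of \<open>U\<close> and \<open>Q\<close>, a negative one over those of
    \<open>P\<close> and \<open>V\<close>; copies are numbered up to \<open>b\<close>.\<close>
  define b where "b = rep m - 1"
  define p where "p = nat r"
  define q where "q = nat (- r)"
  have b: "b < rep m" "int b = int (rep m) - 1" using rep_pos[of m] by (auto simp: b_def)
  have r: "r = int p - int q" by (simp add: p_def q_def)
  have pq: "p \<le> 2 * b" "q \<le> 2 * b" using assms b by (auto simp: p_def q_def)
  have ind: "min p b < rep m" "p - min p b < rep m" "min q b < rep m" "q - min q b < rep m"
    using b pq by auto
  have p2: "int (p - min p b) = int p - int (min p b)" by (simp add: of_nat_diff)
  have q2: "int (q - min q b) = int q - int (min q b)" by (simp add: of_nat_diff)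
  show ?thesis
    unfolding shiftable_def
  proof (intro allI impI)
    fix P U Q V assume less: "P < len m" "U < len m" "Q < len m" "V < len m"
    let ?P = "pad m + min q b * len m + P" and ?U = "pad m + min p b * len m + U"
    let ?Q = "pad m + (p - min p b) * len m + Q" and ?V = "pad m + (q - min q b) * len m + V"
    have "(int ?U - int ?P) - (int ?V - int ?Q)
        = (int U - int P) - (int V - int Q) + r * int (len m)"
      unfolding r of_nat_add of_nat_mult p2 q2 by (simp add: algebra_simps)
    then show "\<exists>P' U' Q' V'. over (Suc m) P' m P \<and> over (Suc m) U' m U \<and> over (Suc m) Q' m Q \<and>
        over (Suc m) V' m V \<and>
        (int U' - int P') - (int V' - int Q') = (int U - int P) - (int V - int Q) + r * int (len m)"
      using over_copy[OF less(1) ind(3)] over_copy[OF less(2) ind(1)]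
        over_copy[OF less(3) ind(2)] over_copy[OF less(4) ind(4)] by blast
  qed
qed

end

text \<open>The bound on \<open>q\<close> makes \<open>q * len m\<close> an admissible change of the defect at level \<open>m\<close>;
  two copies per level suffice to add \<open>len (Suc m)\<close> one level higher.\<close>

locale weakly_mixing_tower = padded_tower +
  assumes rep_ge_2: "2 \<le> rep n"
    and ex_unit_level: "\<exists>m\<ge>N. \<exists>q. len (Suc m) = q * len m + 1 \<and> q \<le> 2 * (rep m - 1)"
begin

text \<open>Levels \<open>m\<close> and \<open>Suc m\<close> contribute \<open>- q * len m\<close> and \<open>len (Suc m) = q * len m + 1\<close>.\<close>

lemma ex_shiftable_unit:
  assumes "\<bar>c\<bar> = 1"
  shows "\<exists>m'\<ge>m. shiftable m m' c"
proof -
  obtain m1 q where m1: "m \<le> m1" "len (Suc m1) = q * len m1 + 1" "q \<le> 2 * (rep m1 - 1)"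
    using ex_unit_level by blast
  have 1: "shiftable m m1 0"
    using m1(1)
  proof (induction m1 rule: dec_induct)
    case (step k)
    have "shiftable k (Suc k) (0 * int (len k))"
      using rep_ge_2[of k] by (intro shiftable_level) simp
    then show ?case using shiftable_trans[OF step.IH] by simp
  qed (rule shiftable_refl)
  have "int q \<le> 2 * (int (rep m1) - 1)" using m1(3) rep_pos[of m1] by arith
  then have 2: "shiftable m1 (Suc m1) (- c * int q * int (len m1))"
    using assms by (intro shiftable_level) (simp add: abs_mult)
  have 3: "shiftable (Suc m1) (Suc (Suc m1)) (c * int (len (Suc m1)))"
    using assms rep_ge_2[of "Suc m1"] by (intro shiftable_level) simp
  have "0 + - c * int q * int (len m1) + c * int (len (Suc m1)) = c"
    unfolding m1(2) by (simp add: algebra_simps)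
  then show ?thesis
    using shiftable_trans[OF shiftable_trans[OF 1 2] 3] m1(1) by (metis le_Suc_eq)
qed

text \<open>Unit changes use two levels each; as unit levels recur, any number of them can be
  performed one above the other.\<close>

lemma ex_shiftable: "\<exists>m'\<ge>m. shiftable m m' c"
proof -
  have "\<exists>m'\<ge>m. shiftable m m' (int k * sgn c)" for k
  proof (induction k)
    case 0
    then show ?case using shiftable_refl by auto
  next
    case (Suc k)
    show ?case
    proof (cases "c = 0")
      case False
      obtain m1 where m1: "m1 \<ge> m" "shiftable m m1 (int k * sgn c)" using Suc.IH by blast
      obtain m2 where m2: "m2 \<ge> m1" "shiftable m1 m2 (sgn c)"
        using ex_shiftable_unit[of "sgn c" m1] False by (auto simp: abs_sgn_eq)
      have "int (Suc k) * sgn c = int k * sgn c + sgn c" by (simp add: algebra_simps)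
      then show ?thesis using shiftable_trans[OF m1(2) m2(2)] m1 m2 order_trans by metis
    qed (use Suc.IH in simp)
  qed
  from this[of "nat \<bar>c\<bar>"] show ?thesis by (simp add: abs_mult_sgn)
qed

text \<open>Once the defect is removed, both walks have the same length. A last lift puts \<open>P\<close>, \<open>Q\<close> into the
  first copy and \<open>U\<close>, \<open>V\<close> into the second one: this makes the common time positive and keeps the
  walks away from the centre, the only vertex that does not determine its successor.\<close>

lemma ex_common_transit:
  assumes less: "P < len m" "U < len m" "Q < len m" "V < len m"
  shows "\<exists>m' P' Q' k. m < m' \<and> over m' P' m P \<and> over m' Q' m Q \<and> 0 < P' \<and> 0 < Q' \<and>
           over m' (P' + k) m U \<and> over m' (Q' + k) m V"
proof -
  obtain n where n: "n \<ge> m" "shiftable m n (- ((int U - int P) - (int V - int Q)))"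
    using ex_shiftable by blast
  from shiftableE[OF n(2) less] obtain P1 U1 Q1 V1 where a:
    "over n P1 m P" "over n U1 m U" "over n Q1 m Q" "over n V1 m V"
    "(int U1 - int P1) - (int V1 - int Q1) = 0" by (metis add.right_inverse)
  note l = a(1-4)[THEN over_lessD]
  have ind: "0 < rep n" "1 < rep n" using rep_ge_2[of n] by auto
  define P' where "P' = pad n + 0 * len n + P1"
  define Q' where "Q' = pad n + 0 * len n + Q1"
  define k where "k = len n + U1 - P1"
  have eq: "P' + k = pad n + 1 * len n + U1" "Q' + k = pad n + 1 * len n + V1"
    using l a(5) by (auto simp: P'_def Q'_def k_def)
  have "over (Suc n) P' n P1" "over (Suc n) Q' n Q1"
    "over (Suc n) (P' + k) n U1" "over (Suc n) (Q' + k) n V1"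
    unfolding eq unfolding P'_def Q'_def by (intro over_copy l ind)+
  then have "over (Suc n) P' m P" "over (Suc n) Q' m Q"
    "over (Suc n) (P' + k) m U" "over (Suc n) (Q' + k) m V"
    using a over_trans by blast+
  moreover have "m < Suc n" "0 < P'" "0 < Q'"
    using n(1) pad_pos[of n] by (auto simp: P'_def Q'_def)
  ultimately show ?thesis by blast
qed

lemma ex_next_stage:
  assumes P: "P < len m" and Q: "Q < len m" and target: "u < len a" "v < len a"
  shows "\<exists>m' P' Q' k. m < m' \<and> over m' P' m P \<and> over m' Q' m Q \<and> 0 < P' \<and> 0 < Q' \<and>
           over m' (P' + k) a u \<and> over m' (Q' + k) a v"
proof -
  let ?n = "max a m"
  obtain P1 U1 Q1 V1 where 1: "over ?n P1 m P" "over ?n U1 a u" "over ?n Q1 m Q" "over ?n V1 a v"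
    using ex_over[OF P, of ?n] ex_over[OF Q, of ?n] ex_over[OF target(1), of ?n]
      ex_over[OF target(2), of ?n] by auto
  from ex_common_transit[OF this[THEN over_lessD]] obtain m' P' Q' k where
    2: "?n < m'" "over m' P' ?n P1" "over m' Q' ?n Q1" "0 < P'" "0 < Q'"
      "over m' (P' + k) ?n U1" "over m' (Q' + k) ?n V1" by blast
  then have "m < m'" by simp
  then show ?thesis using 1 2 over_trans by blast
qed

text \<open>The pair is built in stages, each of which refines both points to a higher level and takes care
  of one target in an enumeration of all pairs of vertices of all levels.\<close>

lemma ex_pair_visiting_all:
  "\<exists>x\<in>X. \<exists>y\<in>X. \<forall>a u v. u < len a \<longrightarrow> v < len a \<longrightarrow>
     (\<exists>k. (f ^^ k) x a = u \<and> (f ^^ k) y a = v)"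
proof -
  \<comment> \<open>A target \<open>(a, u, v)\<close> asks for a time at which the points are at \<open>u\<close> and \<open>v\<close> in level \<open>a\<close>; a
    stage \<open>(m, P, Q)\<close> fixes their positions in level \<open>m\<close>. Triples that are no vertex pairs are skipped.\<close>
  define target :: "nat \<Rightarrow> nat \<times> nat \<times> nat" where "target = from_nat"
  define valid :: "nat \<Rightarrow> nat \<times> nat \<times> nat \<Rightarrow> bool" where
    "valid i z = (case z of (m, P, Q) \<Rightarrow> P < len m \<and> Q < len m)" for i z
  define stage :: "nat \<Rightarrow> nat \<times> nat \<times> nat \<Rightarrow> nat \<times> nat \<times> nat \<Rightarrow> bool" where
    "stage i z z' = (case (z, z', target i) of ((m, P, Q), (m', P', Q'), (a, u, v)) \<Rightarrow>
       m < m' \<and> over m' P' m P \<and> over m' Q' m Q \<and>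
       (u < len a \<longrightarrow> v < len a \<longrightarrow>
         (\<exists>k. 0 < P' \<and> 0 < Q' \<and> over m' (P' + k) a u \<and> over m' (Q' + k) a v)))" for i z z'
  have "\<exists>z'. valid (Suc i) z' \<and> stage i z z'" if z: "valid i z" for i z
  proof -
    obtain m P Q a u v where eq: "z = (m, P, Q)" "target i = (a, u, v)" by (metis prod_cases3)
    have less: "P < len m" "Q < len m" using z by (simp_all add: eq valid_def)
    show ?thesis
    proof (cases "u < len a \<and> v < len a")
      case True
      then obtain m' P' Q' k where "m < m'" "over m' P' m P" "over m' Q' m Q" "0 < P'" "0 < Q'"
          "over m' (P' + k) a u" "over m' (Q' + k) a v"
        using ex_next_stage[OF less] by blast
      then show ?thesis
        by (intro exI[of _ "(m', P', Q')"]) (auto simp: valid_def stage_def eq dest: over_lessD)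
    next
      case False
      obtain P' Q' where "over (Suc m) P' m P" "over (Suc m) Q' m Q"
        using ex_over[OF less(1), of "Suc m"] ex_over[OF less(2), of "Suc m"] by auto
      then show ?thesis using False
        by (intro exI[of _ "(Suc m, P', Q')"]) (auto simp: valid_def stage_def eq dest: over_lessD)
    qed
  qed
  moreover have "valid 0 (0, 0, 0)" by (simp add: valid_def)
  ultimately obtain z where z: "\<And>i. valid i (z i)" "\<And>i. stage i (z i) (z (Suc i))"
    using dependent_nat_choice[of valid stage] by blast
  define M where "M i = fst (z i)" for i
  define P where "P i = fst (snd (z i))" for i
  define Q where "Q i = snd (snd (z i))" for i
  have zi: "z i = (M i, P i, Q i)" for i by (simp add: M_def P_def Q_def)
  have less: "P i < len (M i)" "Q i < len (M i)" for i
    using z(1)[of i] by (simp_all add: valid_def zi)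
  have step: "M i < M (Suc i)" "over (M (Suc i)) (P (Suc i)) (M i) (P i)"
    "over (M (Suc i)) (Q (Suc i)) (M i) (Q i)" for i
    using z(2)[of i] by (auto simp: stage_def zi split: prod.splits)
  obtain x where x: "x \<in> X" "\<And>i. x (M i) = P i"
    using ex_point_through_chain[of M P, OF step(1) less(1) step(2)] by blast
  obtain y where y: "y \<in> X" "\<And>i. y (M i) = Q i"
    using ex_point_through_chain[of M Q, OF step(1) less(2) step(3)] by blast
  have "\<exists>k. (f ^^ k) x a = u \<and> (f ^^ k) y a = v"
    if less_target: "u < len a" "v < len a" for a u v
  proof -
    define i where "i = to_nat (a, u, v)"
    define m where "m = M (Suc i)"
    have "target i = (a, u, v)" by (simp add: target_def i_def)
    then obtain k where k: "0 < P (Suc i)" "0 < Q (Suc i)"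
        "over m (P (Suc i) + k) a u" "over m (Q (Suc i) + k) a v"
      using z(2)[of i] less_target by (auto simp: stage_def zi m_def)
    have visit: "(f ^^ k) w a = b"
      if "w \<in> X" "0 < w m" "over m (w m + k) a b" for w b
    proof -
      have "(f ^^ k) w m = w m + k"
        using iterate_before_centre[OF that(1,2)] over_lessD[OF that(3)] .
      then show ?thesis
        using down_coordinate[OF iterate_mem[OF that(1)], of a m k] that(3)
        by (simp add: over_def)
    qed
    show ?thesis
      using visit[OF x(1)] visit[OF y(1)] k x(2)[of "Suc i"] y(2)[of "Suc i"] by (auto simp: m_def)
  qed
  then show ?thesis using x(1) y(1) by blast
qed

text \<open>Agreement of a coordinate entails agreement of all lower ones, so that a pair which visits all pairs of
  vertices of every level has a dense orbit.\<close>

theorem weakly_mixing: "weakly_mixing X f"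
proof -
  obtain x y where xy: "x \<in> X" "y \<in> X" and
    visit: "\<And>a u v. u < len a \<Longrightarrow> v < len a \<Longrightarrow> \<exists>k. (f ^^ k) x a = u \<and> (f ^^ k) y a = v"
    using ex_pair_visiting_all by blast
  have "(p, q) \<in> closure {(map_prod f f ^^ k) (x, y) | k. True}" if pq: "p \<in> X" "q \<in> X" for p q
  proof -
    have "\<forall>j. \<exists>k. (f ^^ k) x j = p j \<and> (f ^^ k) y j = q j"
      using visit coordinate_less pq by blast
    then obtain k where k: "\<And>j. (f ^^ k j) x j = p j" "\<And>j. (f ^^ k j) y j = q j" by metis
    have conv: "(\<lambda>j. (f ^^ k j) w) \<longlonglongrightarrow> l"
      if w: "w \<in> X" "l \<in> X" "\<And>j. (f ^^ k j) w j = l j" for w l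
    proof (rule tendsto_product_topology)
      fix i
      have "(f ^^ k j) w i = l i" if "i \<le> j" for j
        using down_coordinate[OF iterate_mem[OF w(1), of "k j"] that]
          down_coordinate[OF w(2) that] w(3)[of j] by simp
      then show "(\<lambda>j. (f ^^ k j) w i) \<longlonglongrightarrow> l i"
        by (intro tendsto_eventually eventually_sequentiallyI[of i])
    qed
    have "(\<lambda>j. ((f ^^ k j) x, (f ^^ k j) y)) \<longlonglongrightarrow> (p, q)"
      by (intro tendsto_Pair conv xy pq k)
    then show ?thesis
      unfolding closure_sequential
      by (intro exI[of _ "\<lambda>j. (map_prod f f ^^ k j) (x, y)"]) (auto simp: funpow_map_prod)
  qed
  then show ?thesis
    unfolding weakly_mixing_def topologically_transitive_def
    using xy by (intro bexI[of _ "(x, y)"]) auto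
qed

end

section \<open>Unique ergodicity\<close>

context padded_tower
begin

definition fixed_point :: "nat \<Rightarrow> nat" where
  "fixed_point = (\<lambda>_. 0)"

lemma fixed_point_mem: "fixed_point \<in> X"
  by (intro mem_XI) (simp_all add: fixed_point_def)

lemma f_fixed_point: "f fixed_point = fixed_point"
proof
  fix n
  have "Suc 0 < len (Suc n)" using len_ge_2[of "Suc n"] by simp
  then show "f fixed_point n = fixed_point n"
    unfolding f_eq[OF fixed_point_mem] by (simp add: fixed_point_def bond_1)
qed

lemma continuous_on_f: "continuous_on X f"
proof (rule continuous_on_coordinatewise_then_product)
  fix n
  have "continuous_on X (\<lambda>x. bond (Suc n) (Suc (x (Suc n)) mod len (Suc n)))"
    by (rule continuous_on_compose2[OF _ continuous_coordinate subset_UNIV])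
       (simp add: continuous_on_open_vimage discrete_topology_class.open_discrete)
  then show "continuous_on X (\<lambda>x. f x n)"
    by (subst continuous_on_cong[OF refl f_eq]) simp_all
qed

lemma measurable_f: "f \<in> measurable (restrict_space borel X) (restrict_space borel X)"
  using borel_measurable_continuous_on_restrict[OF continuous_on_f] f_mem
  by (intro measurable_restrict_space2) (auto simp: space_restrict_space)

lemma cylinder_sets: "{x \<in> X. x n \<in> J} \<in> sets (restrict_space borel X)"
proof -
  have "(\<lambda>x. x n) -` J \<inter> space borel \<in> sets (borel :: (nat \<Rightarrow> nat) measure)"
    using borel_measurable_continuous_onI[OF continuous_coordinate]
    by (rule measurable_sets) (simp add: borel_open discrete_topology_class.open_discrete)
  moreover have "{x \<in> X. x n \<in> J} = X \<inter> ((\<lambda>x. x n) -` J \<inter> space borel)" by auto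
  ultimately show ?thesis by (auto simp: sets_restrict_space)
qed

lemma invariant_point_mass:
  "invariant_borel_probability X f (return (restrict_space borel X) fixed_point)"
  unfolding invariant_borel_probability_def
proof (intro conjI ballI)
  let ?M = "return (restrict_space borel X) fixed_point"
  show "prob_space ?M"
    by (rule prob_space_return) (simp add: space_restrict_space fixed_point_mem)
  show "f \<in> measurable ?M ?M"
    using measurable_f by (simp add: measurable_cong_sets[OF sets_return sets_return])
  fix A assume A: "A \<in> sets ?M"
  then have "f -` A \<inter> space ?M \<in> sets (restrict_space borel X)"
    using measurable_sets[OF measurable_f, of A] by simp
  then show "emeasure ?M (f -` A \<inter> space ?M) = emeasure ?M A"
    using A by (simp add: emeasure_return indicator_def f_fixed_point space_restrict_space
        fixed_point_mem)
qed simp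

context
  fixes M :: "(nat \<Rightarrow> nat) measure"
  assumes inv: "invariant_borel_probability X f M"
begin

interpretation prob_space M
  using inv by (simp add: invariant_borel_probability_def)

lemma sets_M: "sets M = sets (restrict_space borel X)"
  using inv by (simp add: invariant_borel_probability_def)

lemma space_M: "space M = X"
  using sets_eq_imp_space_eq[OF sets_M] by (simp add: space_restrict_space)

lemma cylinder_events: "{x \<in> X. x n \<in> J} \<in> events"
  using cylinder_sets sets_M by simp

lemma prob_cylinder:
  assumes "finite J"
  shows "prob {x \<in> X. x n \<in> J} = (\<Sum>j\<in>J. prob {x \<in> X. x n = j})"
proof -
  have "{x \<in> X. x n \<in> J} = (\<Union>j\<in>J. {x \<in> X. x n = j})" by auto
  moreover have "{x \<in> X. x n = j} \<in> events" for j
    using cylinder_events[of n "{j}"] by simp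
  ultimately show ?thesis
    using assms by (simp, intro finite_measure_finite_Union) (auto simp: disjoint_family_on_def)
qed

text \<open>A vertex off the centre that does not come right after the centre is entered only from its
  predecessor on the cycle, and then with certainty; invariance equates the two cylinders.\<close>

lemma prob_next_vertex:
  assumes "0 < j" "Suc j < len n"
  shows "prob {x \<in> X. x n = Suc j} = prob {x \<in> X. x n = j}"
proof -
  have "f x n = Suc j \<longleftrightarrow> x n = j" if "x \<in> X" for x
  proof
    assume "f x n = Suc j"
    then show "x n = j"
      using f_arc[OF that, of n] by (auto simp: tower_def arc_loop_cycle_iff mod_Suc split: if_splits)
  next
    assume "x n = j"
    then show "f x n = Suc j" using f_step[OF that, of n] assms by simp
  qed
  then have "f -` {x \<in> X. x n = Suc j} \<inter> space M = {x \<in> X. x n = j}"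
    using f_mem by (auto simp: space_M)
  moreover have "emeasure M (f -` {x \<in> X. x n = Suc j} \<inter> space M) = emeasure M {x \<in> X. x n = Suc j}"
    using inv cylinder_events[of n "{Suc j}"]
    by (simp add: invariant_borel_probability_def del: vimage_Collect_eq)
  ultimately show ?thesis by (simp add: measure_def)
qed

lemma prob_vertex:
  assumes "0 < j" "j < len n"
  shows "prob {x \<in> X. x n = j} = prob {x \<in> X. x n = 1}"
proof -
  have "1 \<le> j" using assms by simp
  then show ?thesis
    using assms(2)
  proof (induction j rule: dec_induct)
    case (step j)
    then show ?case using prob_next_vertex[of j n] by simp
  qed simp
qed

lemma prob_off_centre: "prob {x \<in> X. x n \<noteq> 0} = real (len n - 1) * prob {x \<in> X. x n = 1}"
proof -
  have "{x \<in> X. x n \<noteq> 0} = {x \<in> X. x n \<in> {1..<len n}}"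
    using coordinate_less by fastforce
  then have "prob {x \<in> X. x n \<noteq> 0} = (\<Sum>j\<in>{1..<len n}. prob {x \<in> X. x n = j})"
    using prob_cylinder[of "{1..<len n}" n] by simp
  also have "\<dots> = (\<Sum>j\<in>{1..<len n}. prob {x \<in> X. x n = 1})"
    by (intro sum.cong prob_vertex) auto
  finally show ?thesis by simp
qed

lemma prob_vertex_1_Suc:
  assumes "1 \<le> n"
  shows "prob {x \<in> X. x n = 1} = real (rep n) * prob {x \<in> X. x (Suc n) = 1}"
proof -
  let ?K = "(\<lambda>i. pad n + i * len n + 1) ` {..<rep n}"
  have "{x \<in> X. x n = 1} = {x \<in> X. x (Suc n) \<in> ?K}"
    using bond_eq_1_iff[OF assms] bond_coordinate by (metis (no_types, lifting))
  then have "prob {x \<in> X. x n = 1} = (\<Sum>j\<in>?K. prob {x \<in> X. x (Suc n) = j})"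
    using prob_cylinder[of ?K "Suc n"] by simp
  also have "\<dots> = (\<Sum>j\<in>?K. prob {x \<in> X. x (Suc n) = 1})"
  proof (intro sum.cong prob_vertex refl)
    fix j assume "j \<in> ?K"
    then obtain i where i: "i < rep n" "j = pad n + i * len n + 1" by auto
    then show "0 < j" "j < len (Suc n)"
      using bond_copy(2)[of 1 n i] len_ge_2[OF assms] by (auto simp: len_Suc)
  qed
  also have "card ?K = rep n"
    using len_pos[of n] by (subst card_image) (auto simp: inj_on_def simp del: len_pos)
  ultimately show ?thesis by simp
qed

lemma prob_vertex_1_scaled:
  assumes "1 \<le> a" "a \<le> n"
  shows "real (\<Prod>i<a. rep i) * prob {x \<in> X. x a = 1} = real (\<Prod>i<n. rep i) * prob {x \<in> X. x n = 1}"
  using assms(2)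
proof (induction n rule: dec_induct)
  case (step n)
  then show ?case using prob_vertex_1_Suc[of n] assms(1) by (simp add: mult.assoc)
qed simp

text \<open>The mass of vertex \<open>1\<close> at level \<open>a\<close> is, up to a constant, \<open>\<Prod>i<n. rep i\<close> times that at level \<open>n\<close>,
  and the latter is at most \<open>1 / (len n - 1)\<close>, since the \<open>len n - 1\<close> vertices off the centre share a mass of at
  most one.\<close>

lemma prob_vertex_1_eq_0:
  assumes lim: "(\<lambda>n. real (\<Prod>i<n. rep i) / real (len n)) \<longlonglongrightarrow> 0" and "1 \<le> a"
  shows "prob {x \<in> X. x a = 1} = 0"
proof -
  define c where "c = real (\<Prod>i<a. rep i) * prob {x \<in> X. x a = 1}"
  have "c \<le> 2 * (real (\<Prod>i<n. rep i) / real (len n))" if "a \<le> n" for n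
  proof -
    have l: "2 \<le> len n" using len_ge_2[of n] that assms(2) by simp
    have "real (len n) * prob {x \<in> X. x n = 1} \<le> real (2 * (len n - 1)) * prob {x \<in> X. x n = 1}"
      using l by (intro mult_right_mono) (simp_all del: of_nat_mult of_nat_diff)
    also have "\<dots> = 2 * prob {x \<in> X. x n \<noteq> 0}" unfolding prob_off_centre by simp
    also have "\<dots> \<le> 2" by simp
    finally have "prob {x \<in> X. x n = 1} \<le> 2 / real (len n)"
      by (simp add: field_simps)
    then have "real (\<Prod>i<n. rep i) * prob {x \<in> X. x n = 1} \<le> real (\<Prod>i<n. rep i) * (2 / real (len n))"
      by (rule mult_left_mono) (rule of_nat_0_le_iff)
    then show ?thesis
      unfolding c_def prob_vertex_1_scaled[OF assms(2) that] by (simp add: mult.commute)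
  qed
  then have "c \<le> 0"
    using tendsto_mult_right_zero[OF lim, of 2] by (intro LIMSEQ_le_const) blast+
  moreover have "0 < real (\<Prod>i<a. rep i)" using rep_pos by (simp add: prod_pos)
  ultimately show ?thesis
    unfolding c_def by (simp add: mult_le_0_iff measure_nonneg order.antisym)
qed

lemma invariant_eq_point_mass:
  assumes lim: "(\<lambda>n. real (\<Prod>i<n. rep i) / real (len n)) \<longlonglongrightarrow> 0"
  shows "M = return (restrict_space borel X) fixed_point"
proof -
  have "AE x in M. x n = 0" for n
  proof (cases "n = 0")
    case True
    then show ?thesis using coordinate_less[of _ 0] by (intro AE_I2) (simp add: space_M len_0)
  next
    case False
    then have "prob {x \<in> X. x n \<noteq> 0} = 0"
      using prob_off_centre prob_vertex_1_eq_0[OF lim, of n] by simp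
    then show ?thesis
      using cylinder_events[of n "- {0}"]
      by (intro AE_I[of _ _ "{x \<in> X. x n \<noteq> 0}"]) (simp_all add: emeasure_eq_measure space_M)
  qed
  then have "AE x in M. \<forall>n. x n = 0" by (simp add: AE_all_countable)
  then have AE: "AE x in M. x = fixed_point" by (simp add: fixed_point_def fun_eq_iff)
  show ?thesis
  proof (rule measure_eqI)
    fix A assume A: "A \<in> sets M"
    have "emeasure M A = indicator A fixed_point"
    proof (cases "fixed_point \<in> A")
      case True
      then have "AE x in M. x \<in> A" using AE by auto
      then show ?thesis using True A by (simp add: emeasure_eq_1_AE)
    next
      case False
      then have "AE x in M. x \<notin> A" using AE by auto
      then show ?thesis using False A by (simp add: AE_iff_null_sets[symmetric] null_setsD1)
    qed
    then show "emeasure M A = emeasure (return (restrict_space borel X) fixed_point) A"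
      using A sets_M by simp
  qed (simp add: sets_M)
qed

end

theorem uniquely_ergodic:
  assumes "(\<lambda>n. real (\<Prod>i<n. rep i) / real (len n)) \<longlonglongrightarrow> 0"
  shows "uniquely_ergodic X f"
  unfolding uniquely_ergodic_def
  using invariant_point_mass invariant_eq_point_mass[OF _ assms] by (rule ex1I)

end

section \<open>The example\<close>

fun block_len :: "nat \<Rightarrow> nat" where
  "block_len 0 = 1"
| "block_len (Suc n) = (if even n then 6 else 10) * block_len n + 1"

text \<open>The paddings are solutions of \<open>block_len (Suc n) = 2 * block_pad n + 5 * block_len n\<close>; halving is exact
  because all lengths are odd.\<close>

definition block_pad :: "nat \<Rightarrow> nat" where
  "block_pad n = ((if even n then 1 else 5) * block_len n + 1) div 2"

lemma odd_block_len: "odd (block_len n)"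
  by (cases n) simp_all

lemma double_block_pad: "2 * block_pad n = (if even n then 1 else 5) * block_len n + 1"
  unfolding block_pad_def using odd_block_len[of n] by simp

interpretation block: padded_tower block_len block_pad "\<lambda>_. 5"
proof
  show "block_len (Suc n) = 2 * block_pad n + 5 * block_len n" for n
    unfolding double_block_pad by simp
  show "0 < block_pad n" for n
    using double_block_pad[of n] by (cases "block_pad n") simp_all
qed simp_all

interpretation block: weakly_mixing_tower block_len block_pad "\<lambda>_. 5"
proof
  show "\<exists>m\<ge>N. \<exists>q. block_len (Suc m) = q * block_len m + 1 \<and> q \<le> 2 * (5 - 1)" for N
    by (intro exI[of _ "2 * N"] conjI exI[of _ 6]) simp_all
qed simp

lemma block_len_ge: "6 ^ n \<le> block_len n"
proof (induction n)
  case (Suc n)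
  have "6 * block_len n \<le> block_len (Suc n)" by simp
  then show ?case using Suc by simp
qed simp

text \<open>At odd levels the padding \<open>2 * block_pad m = 5 * block_len m + 1\<close> is just wide enough.\<close>

lemma block_not_mixing: "\<not> topologically_mixing block.X block.f"
proof (rule block.not_topologically_mixing)
  fix N
  show "\<exists>m\<ge>N. 5 * block_len m \<le> 2 * block_pad m"
    by (intro exI[of _ "2 * N + 1"]) (simp add: double_block_pad del: block_len.simps)
qed

lemma block_uniquely_ergodic: "uniquely_ergodic block.X block.f"
proof (rule block.uniquely_ergodic)
  have le: "real (\<Prod>i<n. 5) / real (block_len n) \<le> (5 / 6) ^ n" for n
  proof -
    have "real (6 ^ n) \<le> real (block_len n)" using block_len_ge[of n] by (simp only: of_nat_le_iff)
    then show ?thesis by (simp add: power_divide frac_le)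
  qed
  show "(\<lambda>n. real (\<Prod>i<n. 5) / real (block_len n)) \<longlonglongrightarrow> 0"
  proof (rule tendsto_sandwich[OF _ _ tendsto_const])
    show "(\<lambda>n. (5 / 6 :: real) ^ n) \<longlonglongrightarrow> 0" by (intro LIMSEQ_realpow_zero) simp_all
    show "\<forall>\<^sub>F n in sequentially. real (\<Prod>i<n. 5) / real (block_len n) \<le> (5 / 6) ^ n"
      using le by (rule always_eventually[OF allI])
    show "\<forall>\<^sub>F n in sequentially. 0 \<le> real (\<Prod>i<n. 5) / real (block_len n)" by simp
  qed
qed

theorem proposition6p32:
  shows "\<exists>(G :: nat \<Rightarrow> nat pair_pre_digraph) (\<phi> :: nat \<Rightarrow> nat \<Rightarrow> nat) (v :: nat \<Rightarrow> nat)
            (e :: nat \<Rightarrow> nat vwalk) (c :: nat \<Rightarrow> nat vwalk)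
            (s :: nat \<Rightarrow> nat) (s' :: nat \<Rightarrow> nat)
            (tbar :: nat \<Rightarrow> nat) (t :: nat \<Rightarrow> nat) (t' :: nat \<Rightarrow> nat).
      bidirectional_covering G \<phi> \<and> KR_covering G \<phi> v \<and> proximal_covering G \<and>
      (\<forall>n\<ge>1. {p. circuit (G n) p \<and> hd p = v n} = {e n, c n} \<and> e n \<noteq> c n \<and>
              vwalk_length (e n) = 1) \<and>
      (\<forall>n\<ge>1. s n > 0 \<and> s' n > 0 \<and> t n \<ge> 2 \<and> t' n \<ge> 2 \<and> tbar n = t n + t' n) \<and>
      (\<forall>n\<ge>1. map (\<phi> (Suc n)) (c (Suc n)) =
              closed_walk_power (e n) (s n) \<oplus> closed_walk_power (c n) (tbar n)
                \<oplus> closed_walk_power (e n) (s' n)) \<and>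
      (\<forall>n\<ge>1. s n = s' n) \<and>
      \<not> topologically_mixing (inverse_limit G \<phi>) (inverse_limit_map G \<phi>) \<and>
      weakly_mixing (inverse_limit G \<phi>) (inverse_limit_map G \<phi>) \<and>
      uniquely_ergodic (inverse_limit G \<phi>) (inverse_limit_map G \<phi>)"
proof (intro exI conjI allI impI)
  let ?c = "\<lambda>n. cycle_walk (block_len n)"
  show "bidirectional_covering block.tower block.bond" by (rule block.bidirectional_covering_tower)
  show "KR_covering block.tower block.bond (\<lambda>_. 0)" by (rule block.KR_covering_tower)
  show "proximal_covering block.tower" by (rule block.proximal_covering_tower)
  show "\<not> topologically_mixing block.X block.f" by (rule block_not_mixing)
  show "weakly_mixing block.X block.f" by (rule block.weakly_mixing)
  show "uniquely_ergodic block.X block.f" by (rule block_uniquely_ergodic)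
  fix n :: nat assume n: "1 \<le> n"
  show "{p. circuit (block.tower n) p \<and> hd p = 0} = {[0, 0], ?c n}"
    unfolding block.tower_def by (rule based_circuits_loop_cycle) simp
  have "length (?c n) = Suc (block_len n)" by (simp add: cycle_walk_def)
  moreover have "length [0, 0 :: nat] = 2" by simp
  ultimately show "[0, 0] \<noteq> ?c n" using block.len_ge_2[OF n] by (metis Suc_1 Suc_n_not_le_n nat.inject)
  show "map (block.bond (Suc n)) (?c (Suc n)) =
      closed_walk_power [0, 0] (block_pad n) \<oplus> closed_walk_power (?c n) 5
        \<oplus> closed_walk_power [0, 0] (block_pad n)"
    by (rule block.bond_cycle_walk)
  show "5 = (2 :: nat) + 3" by simp
qed (use block.pad_pos in simp_all)

end
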